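(* Let $X$ be an implicative-orthomodular lattice, and let $Y\subseteq X$ be a nonempty subset of $X$. The following hold: (1) $Y^c$ is a sublattice of $X$; (2) $\mathcal{C}(X)\subseteq Y^c$; (3) $X^c=\mathcal{C}(X)$.
   Context: A BE algebra is an algebra $(X,\to,1)$ of type $(2,0)$ such that for all $x,y,z\in X$: $x\to x=1$; $x\to 1=1$; $1\to x=x$; $x\to(y\to z)=y\to(x\to z)$. Write $x\le y$ iff $x\to y=1$. It is bounded if there is $0\in X$ with $0\le x$ for all $x\in X$; then $x^*:=x\to 0$. A bounded BE algebra is involutive if $x^{**}=x$ for all $x$. A BE algebra is implicative if $(x\to y)\to x=x$ for all $x,y$. In an involutive BE algebra put $x\Cap y:=((x^*\to y^* )\to y^* )^*$. An implicative-orthomodular lattice is an implicative involutive BE algebra satisfying $x\Cap(y\to x)=x$ for all $x,y$. An element $x$ commutes with $y$, written $x\mathcal{C}y$, if $x=(x\to y^* )\to(x\to y)^*$. The center of $X$ is $\mathcal{C}(X)=\{x\in X\mid x\mathcal{C}y \text{ for all } y\in X\}$. For a nonempty $Y\subseteq X$, the commutor of $Y$ is $Y^c=\{x\in X\mid x\mathcal{C}y\text{ for all }y\in Y\}$; in particular $X^c$ is the commutor of $Y=X$. A sublattice of $X$ here means a subset containing $0$ and $1$ and closed under $\to$. *)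

theory Defs
  imports Main
begin

locale BE_algebra =
  fixes X :: "'a set"
    and imp :: "'a \<Rightarrow> 'a \<Rightarrow> 'a" (infixr "\<rightarrow>" 60)
    and one :: 'a ("\<one>")
  assumes one_closed: "\<one> \<in> X"
    and imp_closed: "\<lbrakk>x \<in> X; y \<in> X\<rbrakk> \<Longrightarrow> x \<rightarrow> y \<in> X"
    and imp_self: "x \<in> X \<Longrightarrow> x \<rightarrow> x = \<one>"
    and imp_one: "x \<in> X \<Longrightarrow> x \<rightarrow> \<one> = \<one>"
    and one_imp: "x \<in> X \<Longrightarrow> \<one> \<rightarrow> x = x"
    and exchange: "\<lbrakk>x \<in> X; y \<in> X; z \<in> X\<rbrakk> \<Longrightarrow> x \<rightarrow> (y \<rightarrow> z) = y \<rightarrow> (x \<rightarrow> z)"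
begin

definition le :: "'a \<Rightarrow> 'a \<Rightarrow> bool" (infix "\<sqsubseteq>" 50)
  where "x \<sqsubseteq> y \<longleftrightarrow> x \<rightarrow> y = \<one>"

end

(* The least element is carried as a parameter. In the involutive case it is unique:
   if 0 and 0' are both least then 0' = (0' \<rightarrow> 0) \<rightarrow> 0 = 1 \<rightarrow> 0 = 0. *)
locale bounded_BE_algebra = BE_algebra +
  fixes zero :: 'a ("\<zero>")
  assumes zero_closed: "\<zero> \<in> X"
    and zero_le: "x \<in> X \<Longrightarrow> \<zero> \<sqsubseteq> x"
begin

definition compl :: "'a \<Rightarrow> 'a" ("_\<^sup>\<star>" [1000] 999)
  where "x\<^sup>\<star> = x \<rightarrow> \<zero>"

end

locale involutive_BE_algebra = bounded_BE_algebra +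
  assumes involutive: "x \<in> X \<Longrightarrow> (x\<^sup>\<star>)\<^sup>\<star> = x"
begin

definition cap :: "'a \<Rightarrow> 'a \<Rightarrow> 'a" (infixl "\<Cap>" 70)
  where "x \<Cap> y = ((x\<^sup>\<star> \<rightarrow> y\<^sup>\<star>) \<rightarrow> y\<^sup>\<star>)\<^sup>\<star>"

end

locale implicative_BE_algebra = BE_algebra +
  assumes implicative: "\<lbrakk>x \<in> X; y \<in> X\<rbrakk> \<Longrightarrow> (x \<rightarrow> y) \<rightarrow> x = x"

locale implicative_orthomodular_lattice =
  implicative_BE_algebra X imp one + involutive_BE_algebra X imp one zero
  for X :: "'a set"
    and imp :: "'a \<Rightarrow> 'a \<Rightarrow> 'a" (infixr "\<rightarrow>" 60)
    and one :: 'a ("\<one>")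
    and zero :: 'a ("\<zero>") +
  assumes orthomodular: "\<lbrakk>x \<in> X; y \<in> X\<rbrakk> \<Longrightarrow> x \<Cap> (y \<rightarrow> x) = x"
begin

definition commutes :: "'a \<Rightarrow> 'a \<Rightarrow> bool" (infix "\<C>" 50)
  where "x \<C> y \<longleftrightarrow> x = (x \<rightarrow> y\<^sup>\<star>) \<rightarrow> (x \<rightarrow> y)\<^sup>\<star>"

definition center :: "'a set"
  where "center = {x \<in> X. \<forall>y\<in>X. x \<C> y}"

definition commutor :: "'a set \<Rightarrow> 'a set"
  where "commutor Y = {x \<in> X. \<forall>y\<in>Y. x \<C> y}"

(* Closure under \<rightarrow> with 0 and 1 gives closure under complement and hence under the
   lattice operations; this is stronger than being a sublattice in the usual sense. *)
definition sublattice :: "'a set \<Rightarrow> bool"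
  where "sublattice S \<longleftrightarrow> S \<subseteq> X \<and> \<zero> \<in> S \<and> \<one> \<in> S \<and> (\<forall>x\<in>S. \<forall>y\<in>S. x \<rightarrow> y \<in> S)"

end

end

theory Submission
  imports Defs
begin

text \<open>
  With \<open>x \<squnion> y = x\<^sup>\<star> \<rightarrow> y\<close> and \<open>x \<sqinter> y = (x\<^sup>\<star> \<squnion> y\<^sup>\<star>)\<^sup>\<star>\<close> the structure is an orthomodular
  lattice in the classical sense, \<open>x \<rightarrow> y\<close> is \<open>x\<^sup>\<star> \<squnion> y\<close>, and \<open>x \<C> y\<close> reads
  \<open>x = (x \<sqinter> y) \<squnion> (x \<sqinter> y\<^sup>\<star>)\<close>. A join of two elements commuting with \<open>y\<close> commutes with \<open>y\<close> by
  monotonicity alone; closure under complement is where the orthomodular law enters, since it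
  makes \<open>\<C>\<close> symmetric and \<open>y \<C> x\<close> depends only on the pair \<open>{x, x\<^sup>\<star>}\<close>.
\<close>

context implicative_orthomodular_lattice
begin

definition join :: "'a \<Rightarrow> 'a \<Rightarrow> 'a" (infixl "\<squnion>" 65)
  where "x \<squnion> y = x\<^sup>\<star> \<rightarrow> y"

definition meet :: "'a \<Rightarrow> 'a \<Rightarrow> 'a" (infixl "\<sqinter>" 70)
  where "x \<sqinter> y = (x\<^sup>\<star> \<squnion> y\<^sup>\<star>)\<^sup>\<star>"

lemma compl_closed [simp]: "x \<in> X \<Longrightarrow> x\<^sup>\<star> \<in> X"
  by (simp add: compl_def imp_closed zero_closed)

lemma join_closed [simp]: "\<lbrakk>x \<in> X; y \<in> X\<rbrakk> \<Longrightarrow> x \<squnion> y \<in> X"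
  by (simp add: join_def imp_closed)

lemma meet_closed [simp]: "\<lbrakk>x \<in> X; y \<in> X\<rbrakk> \<Longrightarrow> x \<sqinter> y \<in> X"
  by (simp add: meet_def)

declare involutive [simp] zero_closed [simp]

lemma imp_eq_join: "x \<in> X \<Longrightarrow> x \<rightarrow> y = x\<^sup>\<star> \<squnion> y"
  by (simp add: join_def)

lemma zero_compl: "\<zero>\<^sup>\<star> = \<one>"
  by (simp add: compl_def imp_self)

text \<open>The exchange law with \<open>\<zero>\<close> in last place swaps
  \<open>x\<^sup>\<star>\<close> and \<open>y\<^sup>\<star>\<close>; the double complements then
  cancel.\<close>

lemma join_commute: "\<lbrakk>x \<in> X; y \<in> X\<rbrakk> \<Longrightarrow> x \<squnion> y = y \<squnion> x"
  using exchange [of "x\<^sup>\<star>" "y\<^sup>\<star>" \<zero>] by (simp add: join_def flip: compl_def)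

lemma join_left_commute: "\<lbrakk>x \<in> X; y \<in> X; z \<in> X\<rbrakk> \<Longrightarrow> x \<squnion> (y \<squnion> z) = y \<squnion> (x \<squnion> z)"
  by (simp add: join_def exchange)

lemma join_assoc: "\<lbrakk>x \<in> X; y \<in> X; z \<in> X\<rbrakk> \<Longrightarrow> (x \<squnion> y) \<squnion> z = x \<squnion> (y \<squnion> z)"
  by (simp add: join_commute [of "x \<squnion> y" z] join_commute [of y z] join_left_commute [of z x y])

lemmas join_ac = join_assoc join_commute join_left_commute

lemma compl_join: "\<lbrakk>x \<in> X; y \<in> X\<rbrakk> \<Longrightarrow> (x \<squnion> y)\<^sup>\<star> = x\<^sup>\<star> \<sqinter> y\<^sup>\<star>"
  by (simp add: meet_def)

lemma compl_meet: "\<lbrakk>x \<in> X; y \<in> X\<rbrakk> \<Longrightarrow> (x \<sqinter> y)\<^sup>\<star> = x\<^sup>\<star> \<squnion> y\<^sup>\<star>"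
  by (simp add: meet_def)

lemma meet_commute: "\<lbrakk>x \<in> X; y \<in> X\<rbrakk> \<Longrightarrow> x \<sqinter> y = y \<sqinter> x"
  by (simp add: meet_def join_commute)

lemma meet_assoc: "\<lbrakk>x \<in> X; y \<in> X; z \<in> X\<rbrakk> \<Longrightarrow> (x \<sqinter> y) \<sqinter> z = x \<sqinter> (y \<sqinter> z)"
  by (simp add: meet_def join_assoc)

text \<open>This is the implicative law at \<open>y\<^sup>\<star>\<close>, since
  \<open>x \<sqinter> y\<close> is the complement of
  \<open>x \<rightarrow> y\<^sup>\<star>\<close>.\<close>

lemma join_meet_absorb: "\<lbrakk>x \<in> X; y \<in> X\<rbrakk> \<Longrightarrow> x \<squnion> (x \<sqinter> y) = x"
  using implicative [of x "y\<^sup>\<star>"]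
  by (simp add: imp_closed imp_eq_join join_commute meet_def)

lemma meet_join_absorb: "\<lbrakk>x \<in> X; y \<in> X\<rbrakk> \<Longrightarrow> x \<sqinter> (x \<squnion> y) = x"
  using join_meet_absorb [of "x\<^sup>\<star>" "y\<^sup>\<star>"] by (simp add: meet_def)

lemma cap_eq: "\<lbrakk>x \<in> X; y \<in> X\<rbrakk> \<Longrightarrow> x \<Cap> y = (x \<squnion> y\<^sup>\<star>) \<sqinter> y"
  by (simp add: cap_def imp_closed imp_eq_join meet_def)

lemma orthomodular_law:
  assumes "x \<in> X" "y \<in> X" "x \<squnion> y = y"
  shows "y = x \<squnion> (y \<sqinter> x\<^sup>\<star>)"
proof -
  \<comment> \<open>The order is encoded by joins: \<open>x \<squnion> y = y\<close> gives
    \<open>y\<^sup>\<star> = x\<^sup>\<star> \<sqinter> y\<^sup>\<star>\<close>, which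
    \<open>x\<^sup>\<star>\<close> absorbs. The axiom at \<open>y\<^sup>\<star>\<close> and
    \<open>x\<close> then becomes the dual of the goal.\<close>
  have "x \<rightarrow> y\<^sup>\<star> = x\<^sup>\<star>"
    using assms join_meet_absorb [of "x\<^sup>\<star>" "y\<^sup>\<star>"] by (simp add: imp_eq_join flip: compl_join)
  then have "(y\<^sup>\<star> \<squnion> x) \<sqinter> x\<^sup>\<star> = y\<^sup>\<star>"
    using assms orthomodular [of "y\<^sup>\<star>" x] by (simp add: cap_eq)
  then have "((y\<^sup>\<star> \<squnion> x) \<sqinter> x\<^sup>\<star>)\<^sup>\<star> = y"
    using assms by simp
  then show ?thesis
    using assms by (simp add: compl_meet compl_join join_commute meet_commute)
qed

lemma commutes_iff:
  "\<lbrakk>x \<in> X; y \<in> X\<rbrakk> \<Longrightarrow> x \<C> y \<longleftrightarrow> x = (x \<sqinter> y) \<squnion> (x \<sqinter> y\<^sup>\<star>)"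
  by (simp add: commutes_def imp_eq_join meet_def)

lemma commutes_compl_right: "\<lbrakk>x \<in> X; y \<in> X; x \<C> y\<rbrakk> \<Longrightarrow> x \<C> y\<^sup>\<star>"
  by (simp add: commutes_iff join_commute)

lemma commutes_sym:
  assumes "x \<in> X" "y \<in> X" "x \<C> y"
  shows "y \<C> x"
proof -
  have "x\<^sup>\<star> = ((x \<sqinter> y) \<squnion> (x \<sqinter> y\<^sup>\<star>))\<^sup>\<star>"
    using assms by (simp add: commutes_iff)
  also have "\<dots> = (y \<squnion> x\<^sup>\<star>) \<sqinter> (x \<sqinter> y)\<^sup>\<star>"
    using assms by (simp add: compl_join compl_meet meet_commute join_commute)
  \<comment> \<open>Meeting with \<open>y\<close> lets absorption remove the factor
    \<open>y \<squnion> x\<^sup>\<star>\<close>.\<close>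
  finally have "y \<sqinter> x\<^sup>\<star> = y \<sqinter> (y \<squnion> x\<^sup>\<star>) \<sqinter> (x \<sqinter> y)\<^sup>\<star>"
    using assms by (simp add: meet_assoc)
  then have "y \<sqinter> x\<^sup>\<star> = y \<sqinter> (x \<sqinter> y)\<^sup>\<star>"
    using assms by (simp add: meet_join_absorb)
  \<comment> \<open>Orthomodularity for \<open>x \<sqinter> y\<close> below \<open>y\<close>; its
    last term was just identified with \<open>y \<sqinter> x\<^sup>\<star>\<close>.\<close>
  moreover have "y = (x \<sqinter> y) \<squnion> (y \<sqinter> (x \<sqinter> y)\<^sup>\<star>)"
    using assms join_meet_absorb [of y x]
    by (intro orthomodular_law) (simp_all add: meet_commute join_commute)
  ultimately show ?thesis
    using assms by (simp add: commutes_iff meet_commute)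
qed

lemma commutes_compl_left: "\<lbrakk>x \<in> X; y \<in> X; x \<C> y\<rbrakk> \<Longrightarrow> x\<^sup>\<star> \<C> y"
  by (meson commutes_sym commutes_compl_right compl_closed)

text \<open>Monotonicity of meeting with \<open>y\<close>, in join form:
  \<open>a \<sqinter> y\<close> is itself a meet of \<open>(a \<squnion> b) \<sqinter> y\<close>
  with \<open>a\<close>, so it is absorbed.\<close>

lemma meet_mono_join:
  assumes "a \<in> X" "b \<in> X" "y \<in> X"
  shows "(a \<sqinter> y) \<squnion> ((a \<squnion> b) \<sqinter> y) = (a \<squnion> b) \<sqinter> y"
proof -
  have "a \<sqinter> y = (a \<squnion> b) \<sqinter> y \<sqinter> a"
    using assms meet_join_absorb [of a b]
    by (metis join_closed meet_assoc meet_commute)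
  then show ?thesis
    using assms join_meet_absorb [of "(a \<squnion> b) \<sqinter> y" a] by (simp add: join_commute)
qed

lemma commutes_join_left:
  assumes "a \<in> X" "b \<in> X" "y \<in> X" "a \<C> y" "b \<C> y"
  shows "a \<squnion> b \<C> y"
proof -
  define c where "c = a \<squnion> b"
  \<comment> \<open>The goal is \<open>c = d\<close>. That \<open>d\<close> lies below
    \<open>c\<close> is absorption; for the converse it suffices that \<open>a\<close> and
    \<open>b\<close> both lie below \<open>d\<close>.\<close>
  define d where "d = (c \<sqinter> y) \<squnion> (c \<sqinter> y\<^sup>\<star>)"
  have X: "c \<in> X" "d \<in> X"
    using assms by (simp_all add: c_def d_def)
  have below: "e \<squnion> d = d" if "e \<in> X" "e \<C> y"
    "\<And>z. z \<in> X \<Longrightarrow> (e \<sqinter> z) \<squnion> (c \<sqinter> z) = c \<sqinter> z" for e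
  proof -
    have "e \<squnion> d = ((e \<sqinter> y) \<squnion> (e \<sqinter> y\<^sup>\<star>)) \<squnion> d"
      using that assms by (simp add: commutes_iff)
    \<comment> \<open>Each piece of \<open>e\<close> is paired with the piece of \<open>c\<close>
      that dominates it.\<close>
    also have "\<dots> = ((e \<sqinter> y) \<squnion> (c \<sqinter> y)) \<squnion> ((e \<sqinter> y\<^sup>\<star>) \<squnion> (c \<sqinter> y\<^sup>\<star>))"
      using that(1) assms X by (simp add: d_def join_ac)
    also have "\<dots> = d"
      using that assms by (simp add: d_def)
    finally show ?thesis .
  qed
  have "a \<squnion> d = d" "b \<squnion> d = d"
    using assms meet_mono_join [of a b] meet_mono_join [of b a]
    by (auto intro!: below simp: c_def join_commute)
  then have "c \<squnion> d = d"
    using assms X by (simp add: c_def join_assoc)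
  moreover have "c \<squnion> d = c"
    using assms X join_assoc [of c "c \<sqinter> y" "c \<sqinter> y\<^sup>\<star>"]
    by (simp add: d_def join_meet_absorb)
  ultimately show ?thesis
    using assms X by (simp add: commutes_iff c_def d_def)
qed

text \<open>Both implications out of \<open>\<zero>\<close> are \<open>\<one>\<close>, leaving
  \<open>\<one> \<rightarrow> \<one>\<^sup>\<star> = \<zero>\<close>.\<close>

lemma zero_commutes: "y \<in> X \<Longrightarrow> \<zero> \<C> y"
  using zero_le by (simp add: commutes_def le_def one_imp imp_closed compl_def imp_self)

lemma sublattice_commutor:
  assumes "Y \<subseteq> X"
  shows "sublattice (commutor Y)"
proof -
  have "\<zero> \<in> commutor Y"
    using assms by (auto simp: commutor_def intro: zero_commutes)
  moreover have compl: "x\<^sup>\<star> \<in> commutor Y" if "x \<in> commutor Y" for x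
    using assms that by (auto simp: commutor_def intro: commutes_compl_left)
  moreover have "x \<squnion> y \<in> commutor Y" if "x \<in> commutor Y" "y \<in> commutor Y" for x y
    using assms that by (auto simp: commutor_def intro: commutes_join_left)
  moreover have "commutor Y \<subseteq> X"
    by (auto simp: commutor_def)
  \<comment> \<open>Complements and joins suffice: \<open>\<one>\<close> is
    \<open>\<zero>\<^sup>\<star>\<close>, and \<open>x \<rightarrow> y\<close> is
    \<open>x\<^sup>\<star> \<squnion> y\<close>.\<close>
  ultimately show ?thesis
    unfolding sublattice_def by (metis imp_eq_join subsetD zero_compl)
qed

end

theorem proposition5p9:
  fixes X Y :: "'a set"
    and imp :: "'a \<Rightarrow> 'a \<Rightarrow> 'a"
    and one zero :: 'a
  assumes "implicative_orthomodular_lattice X imp one zero"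
    and "Y \<subseteq> X" and "Y \<noteq> {}"
  shows "implicative_orthomodular_lattice.sublattice X imp one zero
           (implicative_orthomodular_lattice.commutor X imp zero Y)
       \<and> implicative_orthomodular_lattice.center X imp zero
           \<subseteq> implicative_orthomodular_lattice.commutor X imp zero Y
       \<and> implicative_orthomodular_lattice.commutor X imp zero X
           = implicative_orthomodular_lattice.center X imp zero"
proof -
  interpret implicative_orthomodular_lattice X imp one zero by fact
  show ?thesis
    \<comment> \<open>The center is by definition the commutor of \<open>X\<close>, and testing
      against the smaller set \<open>Y\<close> can only enlarge a commutor.\<close>
    using sublattice_commutor [OF \<open>Y \<subseteq> X\<close>] \<open>Y \<subseteq> X\<close>
    by (auto simp: center_def commutor_def)
qed

end
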